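(* Let $m,n\in\mathbb N$ be arbitrary, let $\mathbf{\Gamma}_{0,loc}$ be the GKSL operator on $\mathbb C^{n^m\times n^m}$ generated by the single matrix $V=I_{n^{m-1}}\otimes\sigma_+$, where $\sigma_+=\sum_{k=1}^{n-1}\sqrt{k(n-k)}\,e_ke_{k+1}^T\in\mathbb C^{n\times n}$, and let $B_0=B_0(\mathbf{\Gamma}_{0,loc})\in\mathbb R^{n^m\times n^m}$ be its matrix representation on diagonal matrices. Let $\Lambda_{0,loc}$ be the toy model on $\Delta^{n^m-1}$ with dissipative generator $B_0$. Then for every initial state $x_0\in\Delta^{n^m-1}$, $$\overline{\mathfrak{reach}_{\Lambda_{0,loc}}(x_0)}=\Delta^{n^m-1}.$$
   Context: $\Delta^{N-1}=\{x\in\mathbb R^N : x_i\ge 0 \text{ for all } i,\ \sum_{i=1}^N x_i=1\}$ is the standard simplex, $(e_k)$ is the standard basis, and $\otimes$ is the Kronecker product. GKSL operator: given matrices $V_1,\dots,V_r\in\mathbb C^{N\times N}$, the GKSL operator generated by them is the linear map on $\mathbb C^{N\times N}$ $$\mathbf{\Gamma}(\rho)=\sum_k\Big(\tfrac12\big(V_k^\dagger V_k\rho+\rho V_k^\dagger V_k\big)-V_k\rho V_k^\dagger\Big).$$ If $\mathbf{\Gamma}$ maps diagonal matrices to diagonal matrices (as is the case here), $B_0(\mathbf{\Gamma})$ denotes the matrix determined by $\operatorname{diag}(B_0(\mathbf{\Gamma})x)=\mathbf{\Gamma}(\operatorname{diag}(x))$ for all vectors $x$. Toy model: given $B_0\in\mathbb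 R^{N\times N}$ such that $e^{-tB_0}$ leaves $\Delta^{N-1}$ invariant for all $t\ge0$, the toy model $\Lambda$ with dissipative generator $B_0$ is the hybrid control system $$\dot x(t)=-B_0x(t),\ x(t_k)=x_k,\ t\in[t_k,t_{k+1});\qquad x_0\in\Delta^{N-1},\ x_{k+1}=\pi_k e^{-(t_{k+1}-t_k)B_0}x_k,\ k\ge0,$$ whose controls are the switching times $0=t_0\le t_1\le t_2\le\dots$ (not accumulating on finite intervals) and the $N\times N$ permutation matrices $\pi_k$. Its reachable set $\mathfrak{reach}_\Lambda(x_0)=\{x(t): x(\cdot)\text{ a solution},\,t\ge0\}$ equals $\mathcal S_\Lambda x_0$, where $\mathcal S_\Lambda\subset\mathbb R^{N\times N}$ is the matrix semigroup generated by $\{e^{-tB_0}: t\ge0\}$ and all $N\times N$ permutation matrices. *)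

theory Defs
  imports "HOL-Analysis.Abstract_Euclidean_Space" "Jordan_Normal_Form.Schur_Decomposition"
begin

definition std_simplex :: "nat \<Rightarrow> real vec set" where
  "std_simplex N = {x \<in> carrier_vec N. (\<forall>i<N. 0 \<le> x $ i) \<and> (\<Sum>i<N. x $ i) = 1}"

text \<open>
  The type of vectors carries no topology, so closures in \<open>\<real>\<^sup>N\<close> are taken in the library
  space \<^const>\<open>Euclidean_space\<close>, whose points are the sequences vanishing from index \<open>N\<close> on.
\<close>

definition vec_coords :: "real vec \<Rightarrow> nat \<Rightarrow> real" where
  "vec_coords v i = (if i < dim_vec v then v $ i else 0)"

definition vec_closure :: "nat \<Rightarrow> real vec set \<Rightarrow> real vec set" where
  "vec_closure N S =
     {y \<in> carrier_vec N. vec_coords y \<in> Euclidean_space N closure_of (vec_coords ` S)}"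

definition kron :: "'a::semiring_0 mat \<Rightarrow> 'a mat \<Rightarrow> 'a mat" where
  "kron A B = mat (dim_row A * dim_row B) (dim_col A * dim_col B)
     (\<lambda>(i, j). A $$ (i div dim_row B, j div dim_col B) * B $$ (i mod dim_row B, j mod dim_col B))"

text \<open>Indices start at 0: the entry in row \<open>i\<close> and column \<open>i + 1\<close> is \<open>sqrt (k * (n - k))\<close>
  with \<open>k = i + 1\<close>.\<close>

definition sigma_plus :: "nat \<Rightarrow> complex mat" where
  "sigma_plus n = mat n n (\<lambda>(i, j).
     if j = i + 1 then complex_of_real (sqrt (real (i + 1) * (real n - real (i + 1)))) else 0)"

definition gksl_term :: "complex mat \<Rightarrow> complex mat \<Rightarrow> complex mat" where
  "gksl_term V \<rho> =
     (1/2) \<cdot>\<^sub>m (mat_adjoint V * V * \<rho> + \<rho> * (mat_adjoint V * V)) - V * \<rho> * mat_adjoint V"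

definition gksl :: "nat \<Rightarrow> complex mat list \<Rightarrow> complex mat \<Rightarrow> complex mat" where
  "gksl N Vs \<rho> = foldr (\<lambda>V acc. gksl_term V \<rho> + acc) Vs (0\<^sub>m N N)"

text \<open>The matrix \<open>B\<^sub>0(\<Gamma>)\<close>, meaningful when \<open>\<Gamma>\<close> is linear, maps diagonal matrices to diagonal
  matrices, and is represented on them by a real matrix.\<close>

definition diag_rep :: "nat \<Rightarrow> (complex mat \<Rightarrow> complex mat) \<Rightarrow> real mat" where
  "diag_rep N \<Gamma> = (THE B. B \<in> carrier_mat N N \<and>
     (\<forall>x \<in> carrier_vec N.
        mat_diag N (\<lambda>i. (map_mat complex_of_real B *\<^sub>v x) $ i) = \<Gamma> (mat_diag N (\<lambda>i. x $ i))))"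

definition mat_exp :: "real mat \<Rightarrow> real mat" where
  "mat_exp A = mat (dim_row A) (dim_row A) (\<lambda>(i, j). \<Sum>k. (A ^\<^sub>m k) $$ (i, j) / fact k)"

definition perm_mat :: "nat \<Rightarrow> (nat \<Rightarrow> nat) \<Rightarrow> real mat" where
  "perm_mat N p = mat N N (\<lambda>(i, j). if i = p j then 1 else 0)"

definition perm_mats :: "nat \<Rightarrow> real mat set" where
  "perm_mats N = {perm_mat N p | p. p permutes {..<N}}"

text \<open>
  \<open>\<tau>\<close> are the switching times, \<open>P\<close> the permutation controls and \<open>\<xi>\<close> the states right after the
  switches. When \<open>\<tau> k = \<tau> (Suc k)\<close> the interval is empty, and neither the initial condition nor
  the differential equation on it constrains \<open>x\<close>.
\<close>

definition toy_solution ::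
  "nat \<Rightarrow> real mat \<Rightarrow> real vec \<Rightarrow> (nat \<Rightarrow> real) \<Rightarrow> (nat \<Rightarrow> real mat) \<Rightarrow> (real \<Rightarrow> real vec) \<Rightarrow> bool" where
  "toy_solution N B x0 \<tau> P x \<longleftrightarrow>
     \<tau> 0 = 0 \<and> mono \<tau> \<and> (\<forall>T. finite {k. \<tau> k \<le> T}) \<and>
     (\<forall>k. P k \<in> perm_mats N) \<and>
     (\<forall>t\<ge>0. x t \<in> carrier_vec N) \<and>
     (\<exists>\<xi>. \<xi> 0 = x0 \<and>
        (\<forall>k. \<xi> (Suc k) = P k *\<^sub>v (mat_exp ((- (\<tau> (Suc k) - \<tau> k)) \<cdot>\<^sub>m B) *\<^sub>v \<xi> k)) \<and>
        (\<forall>k. \<tau> k < \<tau> (Suc k) \<longrightarrow> x (\<tau> k) = \<xi> k) \<and>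
        (\<forall>k. \<forall>t \<in> {\<tau> k..<\<tau> (Suc k)}. \<forall>i<N.
           ((\<lambda>s. x s $ i) has_real_derivative (- (B *\<^sub>v x t)) $ i)
             (at t within {\<tau> k..<\<tau> (Suc k)})))"

definition toy_reach :: "nat \<Rightarrow> real mat \<Rightarrow> real vec \<Rightarrow> real vec set" where
  "toy_reach N B x0 = {x t | \<tau> P x t. toy_solution N B x0 \<tau> P x \<and> 0 \<le> t}"

end

theory Submission
  imports Defs
begin

text \<open>
  On diagonal matrices the generator splits into independent chains of length \<open>n\<close>, each
  carrying population one level down, from position \<open>k\<close> to \<open>k - 1\<close>, at rate
  \<open>(k mod n) * (n - k mod n)\<close>, which vanishes exactly at the bottom of a chain.

  Let \<open>C\<close> be the closure of the points reached by finite control words; it is compact and invariant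
  under permutations and relaxation. Let \<open>v\<close> be a point of \<open>C\<close> nearest to a target \<open>y\<close> and suppose
  \<open>v \<noteq> y\<close>. Permute the coordinates so that \<open>c = y - v\<close> decreases along every chain, with a maximum of
  \<open>c\<close> at the bottom and a minimum at the top of the first chain. Relaxation then moves mass only from
  smaller to larger values of \<open>c\<close>. Where \<open>c\<close> is minimal it is negative, so \<open>v > y \<ge> 0\<close> there,
  and mass is really moved. Hence the squared distance to \<open>y\<close> has negative
  derivative at time \<open>0\<close>, contradicting minimality.
\<close>

unbundle no vec_syntax

subsection \<open>The matrix exponential\<close>

lemma mult_mat_vec_nth:
  fixes A :: "'a::semiring_0 mat"
  assumes "A \<in> carrier_mat N N" "v \<in> carrier_vec N" "i < N"
  shows "(A *\<^sub>v v) $ i = (\<Sum>j<N. A $$ (i, j) * v $ j)"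
  using assms by (auto simp: scalar_prod_def lessThan_atLeast0 intro!: sum.cong)

lemma mult_mat_nth:
  fixes A B :: "'a::semiring_0 mat"
  assumes "A \<in> carrier_mat N N" "B \<in> carrier_mat N N" "i < N" "j < N"
  shows "(A * B) $$ (i, j) = (\<Sum>l<N. A $$ (i, l) * B $$ (l, j))"
  using assms by (auto simp: scalar_prod_def lessThan_atLeast0 intro!: sum.cong)

lemma pow_mat_smult:
  fixes A :: "'a::comm_semiring_1 mat"
  assumes A: "A \<in> carrier_mat N N"
  shows "(t \<cdot>\<^sub>m A) ^\<^sub>m k = t ^ k \<cdot>\<^sub>m (A ^\<^sub>m k)"
proof (induction k)
  case 0
  show ?case using A by (intro eq_matI) auto
next
  case (Suc k)
  have "(t \<cdot>\<^sub>m A) ^\<^sub>m Suc k = (t ^ k \<cdot>\<^sub>m (A ^\<^sub>m k)) * (t \<cdot>\<^sub>m A)"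
    by (simp add: Suc)
  also have "\<dots> = t ^ k \<cdot>\<^sub>m (A ^\<^sub>m k * (t \<cdot>\<^sub>m A))"
    using A by (intro mult_smult_assoc_mat[where n = N]) (auto intro: pow_carrier_mat)
  also have "\<dots> = t ^ k \<cdot>\<^sub>m (t \<cdot>\<^sub>m (A ^\<^sub>m k * A))"
    using A by (subst mult_smult_distrib[where n = N]) (auto intro: pow_carrier_mat)
  finally show ?case
    using A by (auto intro!: eq_matI simp: mult_ac)
qed

text \<open>The recursion of \<open>pow_mat\<close> multiplies on the right, whereas the
  differential equation of the exponential needs the factor \<open>A\<close> on the left.\<close>

lemma pow_mat_Suc_left:
  fixes A :: "'a::semiring_1 mat"
  assumes A: "A \<in> carrier_mat N N"
  shows "A ^\<^sub>m Suc k = A * A ^\<^sub>m k"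
proof (induction k)
  case 0
  show ?case using A by simp
next
  case (Suc k)
  have "A ^\<^sub>m Suc (Suc k) = (A * A ^\<^sub>m k) * A"
    using Suc by simp
  also have "\<dots> = A * (A ^\<^sub>m k * A)"
    using A by (intro assoc_mult_mat[where n\<^sub>2 = N and n\<^sub>3 = N]) (auto intro: pow_carrier_mat)
  finally show ?case by simp
qed

text \<open>The sum of the absolute values of all entries is a submultiplicative norm that dominates
  every single entry. This crude bound is enough for a comparison with a scalar exponential
  series.\<close>

lemma pow_mat_entry_bound:
  fixes A :: "real mat"
  assumes A: "A \<in> carrier_mat N N" and "i < N" "j < N"
  shows "\<bar>(A ^\<^sub>m k) $$ (i, j)\<bar> \<le> (\<Sum>i<N. \<Sum>j<N. \<bar>A $$ (i, j)\<bar>) ^ k"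
  using \<open>j < N\<close>
proof (induction k arbitrary: j)
  case 0
  then show ?case using A \<open>i < N\<close> by simp
next
  case (Suc k)
  let ?C = "\<Sum>i<N. \<Sum>j<N. \<bar>A $$ (i, j)\<bar>"
  have "\<bar>(A ^\<^sub>m Suc k) $$ (i, j)\<bar> = \<bar>\<Sum>l<N. (A ^\<^sub>m k) $$ (i, l) * A $$ (l, j)\<bar>"
    using A \<open>i < N\<close> Suc.prems mult_mat_nth[of "A ^\<^sub>m k" N A i j] by (simp add: pow_carrier_mat)
  also have "\<dots> \<le> (\<Sum>l<N. \<bar>(A ^\<^sub>m k) $$ (i, l)\<bar> * \<bar>A $$ (l, j)\<bar>)"
    by (rule order_trans[OF sum_abs]) (simp add: abs_mult)
  also have "\<dots> \<le> (\<Sum>l<N. ?C ^ k * (\<Sum>j<N. \<bar>A $$ (l, j)\<bar>))"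
  proof (rule sum_mono)
    fix l assume "l \<in> {..<N}"
    then have "\<bar>(A ^\<^sub>m k) $$ (i, l)\<bar> \<le> ?C ^ k" using Suc.IH by simp
    moreover have "\<bar>A $$ (l, j)\<bar> \<le> (\<Sum>j<N. \<bar>A $$ (l, j)\<bar>)"
      using Suc.prems by (intro member_le_sum) auto
    ultimately show "\<bar>(A ^\<^sub>m k) $$ (i, l)\<bar> * \<bar>A $$ (l, j)\<bar> \<le> ?C ^ k * (\<Sum>j<N. \<bar>A $$ (l, j)\<bar>)"
      by (intro mult_mono) (auto intro: order_trans)
  qed
  also have "\<dots> = ?C ^ Suc k" by (simp add: sum_distrib_left[symmetric])
  finally show ?case .
qed

text \<open>Comparison with the scalar exponential series at the entry sum times the absolute value
  of \<open>t\<close>. Convergence at every \<open>t\<close> is what termwise differentiation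
  requires.\<close>

lemma summable_mat_exp:
  fixes A :: "real mat"
  assumes A: "A \<in> carrier_mat N N" and "i < N" "j < N"
  shows "summable (\<lambda>k. (A ^\<^sub>m k) $$ (i, j) / fact k * t ^ k)"
proof -
  let ?C = "\<Sum>i<N. \<Sum>j<N. \<bar>A $$ (i, j)\<bar>"
  have "summable (\<lambda>k. (?C * \<bar>t\<bar>) ^ k / fact k)"
    using summable_exp[of "?C * \<bar>t\<bar>"] by (simp only: divide_inverse mult.commute)
  then show ?thesis
  proof (rule summable_comparison_test'[where N = 0])
    fix k :: nat
    have "\<bar>(A ^\<^sub>m k) $$ (i, j)\<bar> * \<bar>t\<bar> ^ k \<le> ?C ^ k * \<bar>t\<bar> ^ k"
      using pow_mat_entry_bound[OF assms] by (intro mult_right_mono) auto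
    then show "norm ((A ^\<^sub>m k) $$ (i, j) / fact k * t ^ k) \<le> (?C * \<bar>t\<bar>) ^ k / fact k"
      by (simp add: abs_mult power_abs power_mult_distrib divide_right_mono)
  qed
qed

lemma mat_exp_carrier: "A \<in> carrier_mat N N \<Longrightarrow> mat_exp A \<in> carrier_mat N N"
  by (auto simp: mat_exp_def)

lemma mat_exp_smult_nth:
  assumes "A \<in> carrier_mat N N" "i < N" "j < N"
  shows "mat_exp (t \<cdot>\<^sub>m A) $$ (i, j) = (\<Sum>k. (A ^\<^sub>m k) $$ (i, j) / fact k * t ^ k)"
proof -
  have "((t \<cdot>\<^sub>m A) ^\<^sub>m k) $$ (i, j) / fact k = (A ^\<^sub>m k) $$ (i, j) / fact k * t ^ k" for k
    unfolding pow_mat_smult[OF assms(1)] using assms by (simp add: pow_carrier_mat)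
  then show ?thesis using assms by (simp add: mat_exp_def)
qed

lemma mat_exp_zero:
  assumes A: "A \<in> carrier_mat N N"
  shows "mat_exp (0 \<cdot>\<^sub>m A) = 1\<^sub>m N"
proof (rule eq_matI)
  fix i j assume "i < dim_row (1\<^sub>m N)" "j < dim_col (1\<^sub>m N)"
  then have ij: "i < N" "j < N" by auto
  have "mat_exp (0 \<cdot>\<^sub>m A) $$ (i, j) = (A ^\<^sub>m 0) $$ (i, j) / fact 0"
    by (simp only: mat_exp_smult_nth[OF A ij] powser_zero)
  then show "mat_exp (0 \<cdot>\<^sub>m A) $$ (i, j) = 1\<^sub>m N $$ (i, j)"
    using A by simp
qed (use A in \<open>auto simp: mat_exp_def\<close>)

lemma has_real_derivative_mat_exp:
  assumes A: "A \<in> carrier_mat N N" and ij: "i < N" "j < N"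
  shows "((\<lambda>t. mat_exp (t \<cdot>\<^sub>m A) $$ (i, j)) has_real_derivative
           (\<Sum>l<N. A $$ (i, l) * mat_exp (t \<cdot>\<^sub>m A) $$ (l, j))) (at t)"
proof -
  let ?a = "\<lambda>i k. (A ^\<^sub>m k) $$ (i, j) / fact k"
  have "((\<lambda>t. \<Sum>k. ?a i k * t ^ k) has_real_derivative (\<Sum>k. diffs (?a i) k * t ^ k)) (at t)"
    by (rule termdiffs_strong_converges_everywhere) (rule summable_mat_exp[OF A ij])
  \<comment> \<open>The factor \<open>Suc k\<close> from differentiation cancels against
    \<open>fact (Suc k)\<close>. The remaining power of \<open>A\<close> is one too high, and the
    extra factor is split off on the left.\<close>
  moreover have "diffs (?a i) k * t ^ k = (\<Sum>l<N. A $$ (i, l) * (?a l k * t ^ k))" for k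
  proof -
    have "diffs (?a i) k = (A ^\<^sub>m Suc k) $$ (i, j) / fact k"
      by (simp add: diffs_def del: pow_mat.simps of_nat_Suc)
    also have "\<dots> = (\<Sum>l<N. A $$ (i, l) * (A ^\<^sub>m k) $$ (l, j)) / fact k"
      unfolding pow_mat_Suc_left[OF A]
      using mult_mat_nth[of A N "A ^\<^sub>m k" i j] A ij by (simp add: pow_carrier_mat)
    finally show ?thesis by (simp add: sum_distrib_right sum_divide_distrib mult.assoc)
  qed
  moreover have "(\<lambda>k. \<Sum>l<N. A $$ (i, l) * (?a l k * t ^ k)) sums
      (\<Sum>l<N. A $$ (i, l) * (\<Sum>k. ?a l k * t ^ k))"
    by (intro sums_sum sums_mult summable_sums summable_mat_exp[OF A _ ij(2)]) simp
  then have "(\<Sum>k. \<Sum>l<N. A $$ (i, l) * (?a l k * t ^ k)) =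
      (\<Sum>l<N. A $$ (i, l) * (\<Sum>k. ?a l k * t ^ k))"
    by (rule sums_unique[symmetric])
  ultimately have "((\<lambda>t. \<Sum>k. ?a i k * t ^ k) has_real_derivative
      (\<Sum>l<N. A $$ (i, l) * (\<Sum>k. ?a l k * t ^ k))) (at t)"
    by (simp only:)
  moreover have e: "mat_exp (t \<cdot>\<^sub>m A) $$ (l, j) = (\<Sum>k. ?a l k * t ^ k)" if "l < N" for l t
    using A that ij(2) by (rule mat_exp_smult_nth)
  then have "(\<Sum>l<N. A $$ (i, l) * mat_exp (t \<cdot>\<^sub>m A) $$ (l, j)) =
      (\<Sum>l<N. A $$ (i, l) * (\<Sum>k. ?a l k * t ^ k))"
    by (intro sum.cong refl) (simp only: lessThan_iff)
  ultimately show ?thesis by (simp only: e[OF ij(1)])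
qed

lemma has_real_derivative_mat_exp_mult_vec:
  assumes A: "A \<in> carrier_mat N N" and v: "v \<in> carrier_vec N" and i: "i < N"
  shows "((\<lambda>t. (mat_exp (t \<cdot>\<^sub>m A) *\<^sub>v v) $ i) has_real_derivative
           (A *\<^sub>v (mat_exp (t \<cdot>\<^sub>m A) *\<^sub>v v)) $ i) (at t)"
proof -
  let ?E = "\<lambda>t. mat_exp (t \<cdot>\<^sub>m A)"
  have E: "?E t \<in> carrier_mat N N" for t using A by (intro mat_exp_carrier) auto
  have Ev: "?E t *\<^sub>v v \<in> carrier_vec N" for t by (rule mult_mat_vec_carrier[OF E v])
  have "(A *\<^sub>v (?E t *\<^sub>v v)) $ i = (\<Sum>l<N. A $$ (i, l) * (?E t *\<^sub>v v) $ l)"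
    by (rule mult_mat_vec_nth[OF A Ev i])
  also have "\<dots> = (\<Sum>l<N. A $$ (i, l) * (\<Sum>j<N. ?E t $$ (l, j) * v $ j))"
    by (intro sum.cong refl arg_cong2[where f = "(*)"] mult_mat_vec_nth[OF E v]) simp
  also have "\<dots> = (\<Sum>l<N. \<Sum>j<N. A $$ (i, l) * ?E t $$ (l, j) * v $ j)"
    by (simp only: sum_distrib_left mult.assoc)
  also have "\<dots> = (\<Sum>j<N. (\<Sum>l<N. A $$ (i, l) * ?E t $$ (l, j)) * v $ j)"
    by (subst sum.swap) (simp only: sum_distrib_right)
  finally have "(A *\<^sub>v (?E t *\<^sub>v v)) $ i = \<dots>" .
  moreover have "((\<lambda>t. \<Sum>j<N. ?E t $$ (i, j) * v $ j) has_real_derivative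
      (\<Sum>j<N. (\<Sum>l<N. A $$ (i, l) * ?E t $$ (l, j)) * v $ j)) (at t)"
    by (intro DERIV_sum DERIV_cmult_right has_real_derivative_mat_exp[OF A i]) simp
  ultimately show ?thesis by (simp only: mult_mat_vec_nth[OF E v i])
qed

subsection \<open>The dissipative generator\<close>

text \<open>In the equation x' = -Bx, level \<open>j\<close> loses at rate \<open>s j\<close> and
  level \<open>j - 1\<close> gains the same amount, so column \<open>j\<close> sums to zero for
  \<open>j > 0\<close>. For column \<open>0\<close> this amounts to \<open>s 0 = 0\<close>, the
  hypothesis that recurs below.\<close>

definition decay_mat :: "nat \<Rightarrow> (nat \<Rightarrow> real) \<Rightarrow> real mat" where
  "decay_mat N s = mat N N (\<lambda>(i, j). if j = i then s i else if j = Suc i then - s j else 0)"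

text \<open>With r = \<open>k mod n\<close> counted from 0, r(n - r) is the squared entry of
  \<open>sigma_plus\<close> that leads from level r to level r - 1. Its zeros at the multiples of
  \<open>n\<close> decouple the chains, so one bidiagonal matrix describes all of them.\<close>

definition ladder_rate :: "nat \<Rightarrow> nat \<Rightarrow> real" where
  "ladder_rate n k = real (k mod n) * real (n - k mod n)"

lemma decay_mat_carrier: "decay_mat N s \<in> carrier_mat N N"
  by (simp add: decay_mat_def)

lemma ladder_rate_nonneg: "0 \<le> ladder_rate n k"
  by (simp add: ladder_rate_def)

text \<open>Stated over a ring so that it serves both the real matrix and its complex
  embedding.\<close>

lemma sum_bidiagonal:
  fixes f g x :: "nat \<Rightarrow> 'a::comm_ring_1"
  assumes "i < N"
  shows "(\<Sum>j<N. (if j = i then f j else if j = Suc i then g j else 0) * x j) =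
    f i * x i + (if Suc i < N then g (Suc i) * x (Suc i) else 0)"
proof -
  have "(\<Sum>j<N. (if j = i then f j else if j = Suc i then g j else 0) * x j) =
      (\<Sum>j<N. (if j = i then f j * x j else 0) + (if j = Suc i then g j * x j else 0))"
    by (intro sum.cong) auto
  also have "\<dots> = f i * x i + (if Suc i < N then g (Suc i) * x (Suc i) else 0)"
    using assms by (simp add: sum.distrib)
  finally show ?thesis .
qed

lemma decay_mat_mult_vec:
  assumes "x \<in> carrier_vec N" "i < N"
  shows "(decay_mat N s *\<^sub>v x) $ i =
    s i * x $ i - (if Suc i < N then s (Suc i) * x $ Suc i else 0)"
proof -
  have "(decay_mat N s *\<^sub>v x) $ i =
      (\<Sum>j<N. (if j = i then s j else if j = Suc i then - s j else 0) * x $ j)"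
    unfolding mult_mat_vec_nth[OF decay_mat_carrier assms]
    using assms(2) by (intro sum.cong) (auto simp: decay_mat_def)
  then show ?thesis using assms(2) by (subst (asm) sum_bidiagonal) auto
qed

lemma of_real_decay_mat_mult_vec:
  fixes x :: "complex vec"
  assumes "x \<in> carrier_vec N" "i < N"
  shows "(map_mat complex_of_real (decay_mat N s) *\<^sub>v x) $ i =
    of_real (s i) * x $ i - (if Suc i < N then of_real (s (Suc i)) * x $ Suc i else 0)"
proof -
  have "map_mat complex_of_real (decay_mat N s) \<in> carrier_mat N N"
    by (simp add: decay_mat_def)
  from mult_mat_vec_nth[OF this assms]
  have "(map_mat complex_of_real (decay_mat N s) *\<^sub>v x) $ i =
      (\<Sum>j<N. map_mat complex_of_real (decay_mat N s) $$ (i, j) * x $ j)" .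
  also have "\<dots> =
      (\<Sum>j<N. (if j = i then of_real (s j) else if j = Suc i then - of_real (s j) else 0) * x $ j)"
    using assms(2) by (intro sum.cong) (auto simp: decay_mat_def)
  finally show ?thesis using assms(2) by (subst (asm) sum_bidiagonal) auto
qed

section \<open>Identification of the generator on diagonal matrices\<close>

text \<open>A Kronecker product with an identity on the left is block diagonal. The superdiagonal
  positions between two blocks are exactly those where \<open>ladder_rate\<close> vanishes, so the
  rate alone carries the block structure.\<close>

lemma kron_one_sigma_plus:
  assumes "n \<ge> 1"
  shows "kron (1\<^sub>m M) (sigma_plus n) = mat (M * n) (M * n)
    (\<lambda>(i, j). if j = Suc i then complex_of_real (sqrt (ladder_rate n j)) else 0)"
proof (rule eq_matI)
  fix i j
  assume "i < dim_row (mat (M * n) (M * n)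
      (\<lambda>(i, j). if j = Suc i then complex_of_real (sqrt (ladder_rate n j)) else 0))"
    and "j < dim_col (mat (M * n) (M * n)
      (\<lambda>(i, j). if j = Suc i then complex_of_real (sqrt (ladder_rate n j)) else 0))"
  then have ij: "i < M * n" "j < M * n" by auto
  then have div: "i div n < M" "j div n < M"
    by (auto simp: less_mult_imp_div_less)
  have "n > 0" using assms by simp
  then have mod: "i mod n < n" "j mod n < n" by auto
  have entry: "kron (1\<^sub>m M) (sigma_plus n) $$ (i, j) =
    (if i div n = j div n then 1 else 0) *
    (if j mod n = i mod n + 1
     then complex_of_real (sqrt (real (i mod n + 1) * (real n - real (i mod n + 1)))) else 0)"
    using ij div mod by (simp add: kron_def sigma_plus_def)
  have "kron (1\<^sub>m M) (sigma_plus n) $$ (i, j) =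
    (if j = Suc i then complex_of_real (sqrt (ladder_rate n j)) else 0)"
  proof (cases "j = Suc i")
    case True
    show ?thesis
    proof (cases "Suc (i mod n) = n")
      \<comment> \<open>Passage from the end of one block to the start of the next: the Kronecker
        entry is zero, and so is the rate because \<open>j mod n = 0\<close>.\<close>
      case last: True
      then have "j mod n = 0" using True by (simp add: mod_Suc)
      then show ?thesis unfolding entry using True by (simp add: ladder_rate_def)
    next
      case False
      then have "j mod n = i mod n + 1" "j div n = i div n" using True by (simp_all add: mod_Suc div_Suc)
      then show ?thesis unfolding entry using True mod by (simp add: ladder_rate_def of_nat_diff)
    qed
  next
    case False
    have "j = Suc i" if "i div n = j div n" "j mod n = i mod n + 1"
      using that div_mult_mod_eq[of i n] div_mult_mod_eq[of j n] by simp
    with False show ?thesis unfolding entry by auto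
  qed
  then show "kron (1\<^sub>m M) (sigma_plus n) $$ (i, j) = mat (M * n) (M * n)
      (\<lambda>(i, j). if j = Suc i then complex_of_real (sqrt (ladder_rate n j)) else 0) $$ (i, j)"
    using ij by simp
qed (auto simp: kron_def sigma_plus_def)

lemma mat_adjoint_nth:
  assumes "A \<in> carrier_mat n m" "i < m" "j < n"
  shows "mat_adjoint A $$ (i, j) = conjugate (A $$ (j, i))"
  using assms by (auto simp: mat_adjoint_def mat_of_rows_def)

text \<open>\<open>V\<close> is a weighted shift. The product \<open>mat_adjoint V * V\<close> is
  diagonal with entries \<open>s i\<close> and yields the loss term, since the two halves of the
  anticommutator agree on diagonal matrices. Conjugation by \<open>V\<close> moves the weighted
  entry from \<open>Suc i\<close> to \<open>i\<close> and yields the gain.\<close>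

lemma gksl_term_shift_diag:
  fixes N :: nat and s :: "nat \<Rightarrow> real" and x :: "complex vec"
  defines "V \<equiv> mat N N (\<lambda>(i, j). if j = Suc i then complex_of_real (sqrt (s j)) else 0)"
  assumes "s 0 = 0" and s: "\<And>i. 0 \<le> s i" and x: "x \<in> carrier_vec N"
  shows "gksl_term V (mat_diag N (\<lambda>i. x $ i)) =
    mat_diag N (\<lambda>i. (map_mat complex_of_real (decay_mat N s) *\<^sub>v x) $ i)"
proof -
  let ?D = "mat_diag N (\<lambda>i. x $ i)"
  have V: "V \<in> carrier_mat N N" by (simp add: V_def)
  have adj: "mat_adjoint V \<in> carrier_mat N N"
    using V by (auto simp: mat_adjoint_def mat_of_rows_def)
  have adj_nth: "mat_adjoint V $$ (i, j) = (if i = Suc j then complex_of_real (sqrt (s i)) else 0)"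
    if "i < N" "j < N" for i j
    using that mat_adjoint_nth[OF V that] by (simp add: V_def conjugate_complex_def)
  have sqrt_sq: "complex_of_real (sqrt (s i)) * complex_of_real (sqrt (s i)) = of_real (s i)" for i
    using s[of i] by (metis of_real_mult real_sqrt_mult_self abs_of_nonneg)
  have VV: "mat_adjoint V * V = mat_diag N (\<lambda>i. of_real (s i))"
  proof (rule eq_matI)
    fix i j assume "i < dim_row (mat_diag N (\<lambda>i. complex_of_real (s i)))"
      "j < dim_col (mat_diag N (\<lambda>i. complex_of_real (s i)))"
    then have ij: "i < N" "j < N" by (auto simp: mat_diag_def)
    have "(mat_adjoint V * V) $$ (i, j) =
        (\<Sum>l<N. mat_adjoint V $$ (i, l) * V $$ (l, j))"
      by (rule mult_mat_nth[OF adj V ij])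
    \<comment> \<open>For \<open>i = 0\<close> truncated subtraction gives \<open>i - 1 = 0\<close>,
      hence the guard \<open>0 < i\<close>: column \<open>0\<close> of \<open>V\<close> is empty.
      The following equation accounts for this entry by \<open>s 0 = 0\<close>.\<close>
    also have "\<dots> = (\<Sum>l<N. if l = i - 1 then if i = j \<and> 0 < i then of_real (s i) else 0 else 0)"
      using ij by (intro sum.cong) (auto simp: adj_nth, auto simp: V_def sqrt_sq)
    also have "\<dots> = (if i = j then of_real (s i) else 0)"
      using ij \<open>s 0 = 0\<close> by (auto)
    finally show "(mat_adjoint V * V) $$ (i, j) = mat_diag N (\<lambda>i. complex_of_real (s i)) $$ (i, j)"
      using ij by (simp add: mat_diag_def)
  qed (use V adj in \<open>auto simp: mat_diag_def\<close>)
  have VDV: "V * ?D * mat_adjoint V =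
      mat_diag N (\<lambda>i. if Suc i < N then of_real (s (Suc i)) * x $ Suc i else 0)" (is "_ = ?E")
  proof (rule eq_matI)
    fix i j assume "i < dim_row ?E" "j < dim_col ?E"
    then have ij: "i < N" "j < N" by (auto simp: mat_diag_def)
    have VD: "V * ?D \<in> carrier_mat N N" using V by (auto simp: mat_diag_def)
    have "(V * ?D * mat_adjoint V) $$ (i, j) =
        (\<Sum>l<N. (V * ?D) $$ (i, l) * mat_adjoint V $$ (l, j))"
      by (rule mult_mat_nth[OF VD adj ij])
    also have "\<dots> = (\<Sum>l<N. if l = Suc i then if i = j then of_real (s l) * x $ l else 0 else 0)"
    proof (rule sum.cong)
      fix l assume "l \<in> {..<N}"
      then have l: "l < N" by simp
      have "(V * ?D) $$ (i, l) = V $$ (i, l) * x $ l"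
        using mat_diag_mult_right[OF V, of "\<lambda>i. x $ i"] ij l by simp
      also have "V $$ (i, l) = (if l = Suc i then complex_of_real (sqrt (s l)) else 0)"
        using ij l by (simp add: V_def)
      finally show "(V * ?D) $$ (i, l) * mat_adjoint V $$ (l, j) =
          (if l = Suc i then if i = j then of_real (s l) * x $ l else 0 else 0)"
        unfolding adj_nth[OF l ij(2)] using sqrt_sq[of l] by auto
    qed simp
    finally show "(V * ?D * mat_adjoint V) $$ (i, j) = ?E $$ (i, j)"
      using ij by (auto simp: mat_diag_def)
  qed (use V adj in \<open>auto simp: mat_diag_def\<close>)
  show ?thesis
    unfolding gksl_term_def VV VDV mat_diag_diag
    using x by (intro eq_matI)
      (auto simp: mat_diag_def of_real_decay_mat_mult_vec simp del: index_mult_mat_vec)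
qed

text \<open>Unit vectors determine a matrix and \<open>complex_of_real\<close> is injective, so at
  most one real matrix represents the operator. This uniqueness evaluates the definite description
  in \<open>diag_rep\<close>.\<close>

lemma diag_rep_eqI:
  assumes B: "B \<in> carrier_mat N N"
    and rep: "\<And>x. x \<in> carrier_vec N \<Longrightarrow>
      mat_diag N (\<lambda>i. (map_mat complex_of_real B *\<^sub>v x) $ i) = \<Gamma> (mat_diag N (\<lambda>i. x $ i))"
  shows "diag_rep N \<Gamma> = B"
  unfolding diag_rep_def
proof (rule the_equality)
  fix C
  assume C: "C \<in> carrier_mat N N \<and> (\<forall>x \<in> carrier_vec N.
    mat_diag N (\<lambda>i. (map_mat complex_of_real C *\<^sub>v x) $ i) = \<Gamma> (mat_diag N (\<lambda>i. x $ i)))"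
  show "C = B"
  proof (rule eq_matI)
    fix i j assume "i < dim_row B" "j < dim_col B"
    then have ij: "i < N" "j < N" using B by auto
    have unit: "(map_mat complex_of_real M *\<^sub>v unit_vec N j) $ i = of_real (M $$ (i, j))"
      if "M \<in> carrier_mat N N" for M
    proof -
      have "map_mat complex_of_real M \<in> carrier_mat N N" using that by simp
      from mult_mat_vec_nth[OF this _ ij(1), of "unit_vec N j"]
      have "(map_mat complex_of_real M *\<^sub>v unit_vec N j) $ i =
          (\<Sum>l<N. map_mat complex_of_real M $$ (i, l) * unit_vec N j $ l)" by simp
      also have "\<dots> = (\<Sum>l<N. if l = j then of_real (M $$ (i, l)) else 0)"
        using that ij by (intro sum.cong) auto
      finally show ?thesis using ij by simp
    qed
    have "mat_diag N (\<lambda>i. (map_mat complex_of_real C *\<^sub>v unit_vec N j) $ i) $$ (i, i) =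
      mat_diag N (\<lambda>i. (map_mat complex_of_real B *\<^sub>v unit_vec N j) $ i) $$ (i, i)"
      using C rep[of "unit_vec N j"] by simp
    then have "(map_mat complex_of_real C *\<^sub>v unit_vec N j) $ i =
      (map_mat complex_of_real B *\<^sub>v unit_vec N j) $ i"
      using ij by (simp add: mat_diag_def del: index_mult_mat_vec)
    then show "C $$ (i, j) = B $$ (i, j)" using unit B C by simp
  qed (use B C in auto)
qed (use B rep in auto)

lemma diag_rep_gksl_ladder:
  assumes "n \<ge> 1"
  shows "diag_rep (M * n) (gksl (M * n) [kron (1\<^sub>m M) (sigma_plus n)]) =
    decay_mat (M * n) (ladder_rate n)"
proof (rule diag_rep_eqI[OF decay_mat_carrier])
  fix x :: "complex vec" assume x: "x \<in> carrier_vec (M * n)"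
  let ?E = "mat_diag (M * n)
    (\<lambda>i. (map_mat complex_of_real (decay_mat (M * n) (ladder_rate n)) *\<^sub>v x) $ i)"
  have "gksl (M * n) [kron (1\<^sub>m M) (sigma_plus n)] (mat_diag (M * n) (\<lambda>i. x $ i)) =
      ?E + 0\<^sub>m (M * n) (M * n)"
    using gksl_term_shift_diag[OF _ ladder_rate_nonneg x] assms
    by (simp add: gksl_def kron_one_sigma_plus ladder_rate_def[of _ 0])
  then show "?E = gksl (M * n) [kron (1\<^sub>m M) (sigma_plus n)] (mat_diag (M * n) (\<lambda>i. x $ i))"
    by (simp add: mat_diag_def)
qed

subsection \<open>Invariance of the simplex\<close>

text \<open>The interval is half open because a trajectory obeys the differential equation only up
  to the next switching time. Differentiability inside and one-sided continuity at \<open>a\<close>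
  suffice for the mean value argument.\<close>

lemma nondecreasing_Ico:
  fixes f f' :: "real \<Rightarrow> real"
  assumes deriv: "\<And>u. u \<in> {a..<b} \<Longrightarrow> (f has_real_derivative f' u) (at u within {a..<b})"
    and nonneg: "\<And>u. u \<in> {a..<b} \<Longrightarrow> 0 \<le> f' u" and t: "t \<in> {a..<b}"
  shows "f a \<le> f t"
proof (rule DERIV_nonneg_imp_increasing_open[where f = f and a = a and b = t])
  show "a \<le> t" using t by simp
  show "\<exists>y. DERIV f u :> y \<and> 0 \<le> y" if "a < u" "u < t" for u
  proof -
    have "at u within {a..<b} = at u"
      using that t by (intro at_within_open_subset[where S = "{a<..<b}"]) auto
    then show ?thesis using deriv[of u] nonneg[of u] that t by auto
  qed
  have "continuous_on {a..<b} f"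
    using deriv by (rule DERIV_continuous_on)
  then show "continuous_on {a..t} f"
    by (rule continuous_on_subset) (use t in auto)
qed

lemma decay_flow_simplex:
  assumes s0: "s 0 = 0" and s: "\<And>i. 0 \<le> s i"
    and deriv: "\<And>t i. t \<in> {a..<b} \<Longrightarrow> i < N \<Longrightarrow>
      ((\<lambda>u. x u $ i) has_real_derivative (- (decay_mat N s *\<^sub>v x t)) $ i) (at t within {a..<b})"
    and carrier: "\<And>t. t \<in> {a..<b} \<Longrightarrow> x t \<in> carrier_vec N"
    and init: "x a \<in> std_simplex N" and t: "t \<in> {a..<b}"
  shows "x t \<in> std_simplex N"
proof -
  have rhs: "(- (decay_mat N s *\<^sub>v x u)) $ i =
      (if Suc i < N then s (Suc i) * x u $ Suc i else 0) - s i * x u $ i"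
    if "u \<in> {a..<b}" "i < N" for u i
    using decay_mat_mult_vec[OF carrier[OF that(1)] that(2), of s] that(2) by (simp add: decay_mat_def)
  have ode: "((\<lambda>u. x u $ i) has_real_derivative
      (if Suc i < N then s (Suc i) * x u $ Suc i else 0) - s i * x u $ i) (at u within {a..<b})"
    if "u \<in> {a..<b}" "i < N" for u i
    using deriv[OF that] unfolding rhs[OF that] .
  have "0 \<le> x u $ i" if "i < N" "u \<in> {a..<b}" for i u
    using that
  proof (induction "N - i" arbitrary: i u rule: less_induct)
    case less
    \<comment> \<open>The integrating factor removes the loss term, leaving only the inflow from above.\<close>
    have "exp (s i * a) * x a $ i \<le> exp (s i * u) * x u $ i"
    proof (rule nondecreasing_Ico[where f = "\<lambda>v. exp (s i * v) * x v $ i" and a = a and b = b])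
      fix v assume v: "v \<in> {a..<b}"
      let ?in = "if Suc i < N then s (Suc i) * x v $ Suc i else 0"
      show "((\<lambda>v. exp (s i * v) * x v $ i) has_real_derivative exp (s i * v) * ?in)
          (at v within {a..<b})"
        by (rule derivative_eq_intros ode[OF v less.prems(1)] refl)+ (simp add: algebra_simps)
      show "0 \<le> exp (s i * v) * ?in"
        using less.hyps[of "Suc i" v] less.prems(1) v s by auto
    qed (rule less.prems)
    moreover have "0 \<le> exp (s i * a) * x a $ i"
      using init less.prems(1) by (simp add: std_simplex_def)
    ultimately have "0 \<le> exp (s i * u) * x u $ i" by linarith
    then show ?case by (simp add: zero_le_mult_iff)
  qed
  moreover have "(\<Sum>i<N. x t $ i) = 1"
  proof -
    have sum: "((\<lambda>u. \<Sum>i<N. x u $ i) has_real_derivative 0) (at u within {a..<b})"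
      if u: "u \<in> {a..<b}" for u
    proof -
      \<comment> \<open>The guard \<open>i < N\<close> on the loss term, always true here, gives
        both terms the same shape. Telescoping leaves the values at \<open>N\<close> and at
        \<open>0\<close>, which both vanish.\<close>
      have "(\<Sum>i<N. (if Suc i < N then s (Suc i) * x u $ Suc i else 0) - s i * x u $ i) =
          (\<Sum>i<N. (if Suc i < N then s (Suc i) * x u $ Suc i else 0) -
            (if i < N then s i * x u $ i else 0))"
        by (intro sum.cong) auto
      also have "\<dots> = 0"
        by (subst sum_lessThan_telescope) (simp add: s0)
      finally show ?thesis
        using DERIV_sum[of "{..<N}" "\<lambda>u i. x u $ i", OF ode[OF u]] by simp
    qed
    have "(\<Sum>i<N. x a $ i) \<le> (\<Sum>i<N. x t $ i)"
      by (rule nondecreasing_Ico[OF sum _ t]) auto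
    \<comment> \<open>Constancy is obtained as monotonicity of the sum and of its negative.\<close>
    moreover have "- (\<Sum>i<N. x a $ i) \<le> - (\<Sum>i<N. x t $ i)"
    proof (rule nondecreasing_Ico[where f' = "\<lambda>_. 0", OF _ _ t])
      show "((\<lambda>u. - (\<Sum>i<N. x u $ i)) has_real_derivative 0) (at u within {a..<b})"
        if "u \<in> {a..<b}" for u
        using DERIV_minus[OF sum[OF that]] by simp
    qed simp
    ultimately show ?thesis using init by (simp add: std_simplex_def)
  qed
  ultimately show ?thesis using carrier[OF t] t by (simp add: std_simplex_def)
qed

lemma mat_exp_flow:
  assumes B: "B \<in> carrier_mat N N" and v: "v \<in> carrier_vec N" and i: "i < N"
  shows "((\<lambda>u. (mat_exp ((- (u - c)) \<cdot>\<^sub>m B) *\<^sub>v v) $ i) has_real_derivative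
    (- (B *\<^sub>v (mat_exp ((- (t - c)) \<cdot>\<^sub>m B) *\<^sub>v v))) $ i) (at t within S)"
proof -
  have "((\<lambda>u. - (u - c)) has_real_derivative - 1) (at t within S)"
    by (auto intro!: derivative_eq_intros)
  from DERIV_chain2[OF has_real_derivative_mat_exp_mult_vec[OF B v i] this]
  show ?thesis using B i by simp
qed

lemma mat_exp_simplex:
  assumes "s 0 = 0" "\<And>i. 0 \<le> s i" and v: "v \<in> std_simplex N" and "0 \<le> t"
  shows "mat_exp ((- t) \<cdot>\<^sub>m decay_mat N s) *\<^sub>v v \<in> std_simplex N"
proof -
  let ?x = "\<lambda>u. mat_exp ((- (u - 0)) \<cdot>\<^sub>m decay_mat N s) *\<^sub>v v"
  have vc: "v \<in> carrier_vec N" using v by (simp add: std_simplex_def)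
  have "?x t \<in> std_simplex N"
  \<comment> \<open>The right endpoint \<open>t + 1\<close> places \<open>t\<close> inside a
    half-open interval.\<close>
  proof (rule decay_flow_simplex[where x = ?x and a = 0 and b = "t + 1" and s = s and N = N])
    show "((\<lambda>u. ?x u $ i) has_real_derivative (- (decay_mat N s *\<^sub>v ?x u)) $ i) (at u within {0..<t + 1})"
      if "i < N" for u i
      using mat_exp_flow[OF decay_mat_carrier vc that] .
    show "?x u \<in> carrier_vec N" for u
      by (rule mult_mat_vec_carrier[OF _ vc], rule mat_exp_carrier) (simp add: decay_mat_def)
    show "?x 0 \<in> std_simplex N"
      using mat_exp_zero[OF decay_mat_carrier, of N s] v vc by simp
  qed (use assms in auto)
  then show ?thesis by simp
qed

section \<open>Permutation controls and invariance of the reachable set\<close>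

lemma perm_mats_carrier: "P \<in> perm_mats N \<Longrightarrow> P \<in> carrier_mat N N"
  by (auto simp: perm_mats_def perm_mat_def)

text \<open>Column \<open>j\<close> of the permutation matrix has its one in row \<open>p j\<close>.
  Indexing the result by \<open>p j\<close> avoids the inverse permutation.\<close>

lemma perm_mat_mult_vec:
  assumes p: "p permutes {..<N}" and v: "v \<in> carrier_vec N" and j: "j < N"
  shows "(perm_mat N p *\<^sub>v v) $ p j = v $ j"
proof -
  have pj: "p j < N" using permutes_in_image[OF p] j by auto
  have "perm_mat N p \<in> carrier_mat N N" by (simp add: perm_mat_def)
  from mult_mat_vec_nth[OF this v pj]
  have "(perm_mat N p *\<^sub>v v) $ p j = (\<Sum>l<N. perm_mat N p $$ (p j, l) * v $ l)" .
  also have "\<dots> = (\<Sum>l<N. if l = j then v $ l else 0)"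
    using pj by (intro sum.cong) (auto simp: perm_mat_def inj_eq[OF permutes_inj[OF p]])
  finally show ?thesis using j by simp
qed

lemma perm_mat_simplex:
  assumes "P \<in> perm_mats N" and v: "v \<in> std_simplex N"
  shows "P *\<^sub>v v \<in> std_simplex N"
proof -
  obtain p where P: "P = perm_mat N p" and p: "p permutes {..<N}"
    using assms(1) by (auto simp: perm_mats_def)
  have vc: "v \<in> carrier_vec N" using v by (simp add: std_simplex_def)
  note entry = perm_mat_mult_vec[OF p vc]
  have "0 \<le> (P *\<^sub>v v) $ i" if "i < N" for i
  proof -
    obtain j where "i = p j" "j < N"
      using \<open>i < N\<close> permutes_image[OF p] by (metis imageE lessThan_iff)
    then show ?thesis using entry v by (simp add: P std_simplex_def)
  qed
  moreover have "(\<Sum>i<N. (P *\<^sub>v v) $ i) = (\<Sum>j<N. (P *\<^sub>v v) $ p j)"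
    by (rule sum.permute[OF p, unfolded comp_def])
  ultimately show ?thesis
    using v entry mult_mat_vec_carrier[OF perm_mats_carrier[OF assms(1)] vc]
    by (simp add: P std_simplex_def)
qed

text \<open>The states just after the switches stay in the simplex by induction; between two
  switches \<open>decay_flow_simplex\<close> applies to the given trajectory itself.\<close>

lemma toy_reach_simplex:
  assumes s: "s 0 = 0" "\<And>i. 0 \<le> s i" and x0: "x0 \<in> std_simplex N"
  shows "toy_reach N (decay_mat N s) x0 \<subseteq> std_simplex N"
proof
  fix w assume "w \<in> toy_reach N (decay_mat N s) x0"
  then obtain \<tau> P x t where w: "w = x t" and "0 \<le> t"
    and sol: "toy_solution N (decay_mat N s) x0 \<tau> P x"
    by (auto simp: toy_reach_def)
  from sol obtain \<xi> where \<tau>: "\<tau> 0 = 0" "mono \<tau>" "finite {k. \<tau> k \<le> t}"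
    and P: "\<And>k. P k \<in> perm_mats N" and carrier: "\<And>t. 0 \<le> t \<Longrightarrow> x t \<in> carrier_vec N"
    and \<xi>0: "\<xi> 0 = x0"
    and \<xi>: "\<And>k. \<xi> (Suc k) =
      P k *\<^sub>v (mat_exp ((- (\<tau> (Suc k) - \<tau> k)) \<cdot>\<^sub>m decay_mat N s) *\<^sub>v \<xi> k)"
    and start: "\<And>k. \<tau> k < \<tau> (Suc k) \<Longrightarrow> x (\<tau> k) = \<xi> k"
    and ode: "\<And>k t i. t \<in> {\<tau> k..<\<tau> (Suc k)} \<Longrightarrow> i < N \<Longrightarrow>
      ((\<lambda>s. x s $ i) has_real_derivative (- (decay_mat N s *\<^sub>v x t)) $ i)
        (at t within {\<tau> k..<\<tau> (Suc k)})"
    unfolding toy_solution_def by blast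
  have \<xi>_simplex: "\<xi> k \<in> std_simplex N" for k
  proof (induction k)
    case (Suc k)
    have "0 \<le> \<tau> (Suc k) - \<tau> k" using \<open>mono \<tau>\<close> by (simp add: monoD)
    from perm_mat_simplex[OF P mat_exp_simplex[of s, OF s Suc this]] show ?case
      unfolding \<xi> .
  qed (simp add: \<xi>0 x0)
  \<comment> \<open>Non-accumulation makes this set finite, so there is a last switch up to time
    \<open>t\<close>. Being the last, it opens a nonempty interval, and \<open>start\<close> applies
    even if several switches coincide.\<close>
  define k where "k = Max {k. \<tau> k \<le> t}"
  have "0 \<in> {k. \<tau> k \<le> t}" using \<tau>(1) \<open>0 \<le> t\<close> by simp
  then have "\<tau> k \<le> t" using Max_in[OF \<tau>(3)] unfolding k_def by blast
  moreover have "t < \<tau> (Suc k)"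
    using Max_ge[OF \<tau>(3), of "Suc k"] unfolding k_def[symmetric] by force
  ultimately have t: "t \<in> {\<tau> k..<\<tau> (Suc k)}" by simp
  have "0 \<le> \<tau> k" using \<tau>(1,2) monoD[of \<tau> 0 k] by simp
  show "w \<in> std_simplex N"
    unfolding w
  proof (rule decay_flow_simplex[where s = s, OF s ode _ _ t])
    show "x (\<tau> k) \<in> std_simplex N"
      using start[of k] \<xi>_simplex t by simp
    show "x u \<in> carrier_vec N" if "u \<in> {\<tau> k..<\<tau> (Suc k)}" for u
      using carrier that \<open>0 \<le> \<tau> k\<close> by simp
  qed
qed

subsection \<open>Closures and control words\<close>

text \<open>The points of \<open>Euclidean_space N\<close> carry the subspace topology of the
  product topology, and the latter is the topology of the function type. The ordinary
  \<open>closure\<close> gives access to compactness and continuity there.\<close>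

lemma vec_closure_eq:
  assumes "S \<subseteq> carrier_vec N"
  shows "vec_closure N S = {y \<in> carrier_vec N. vec_coords y \<in> closure (vec_coords ` S)}"
proof -
  have "{x. \<forall>i\<ge>N. x i = 0} \<inter> vec_coords ` S = vec_coords ` S"
    using assms by (auto simp: vec_coords_def)
  then have "Euclidean_space N closure_of (vec_coords ` S) =
      {x. \<forall>i\<ge>N. x i = 0} \<inter> closure (vec_coords ` S)"
    by (simp add: Euclidean_space_def closure_of_subtopology euclidean_product_topology)
  then show ?thesis by (auto simp: vec_closure_def vec_coords_def)
qed

text \<open>The simplex as a set of sequences, in a type that carries a topology.\<close>

definition coord_simplex :: "nat \<Rightarrow> (nat \<Rightarrow> real) set" where
  "coord_simplex N = {z. (\<forall>i. 0 \<le> z i) \<and> (\<forall>i. N \<le> i \<longrightarrow> z i = 0) \<and> (\<Sum>i<N. z i) = 1}"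

lemma vec_coords_simplex_iff:
  assumes "v \<in> carrier_vec N"
  shows "vec_coords v \<in> coord_simplex N \<longleftrightarrow> v \<in> std_simplex N"
  using assms by (auto simp: coord_simplex_def std_simplex_def vec_coords_def)

lemma vec_coords_vec: "z \<in> coord_simplex N \<Longrightarrow> vec_coords (vec N z) = z"
  by (auto simp: coord_simplex_def vec_coords_def fun_eq_iff)

lemma closed_coord_simplex: "closed (coord_simplex N)"
proof -
  have coord: "continuous_on UNIV (\<lambda>z :: nat \<Rightarrow> real. z i)" for i
    by simp
  show ?thesis
    unfolding coord_simplex_def
    by (intro closed_Collect_conj closed_Collect_all closed_Collect_imp closed_Collect_le
        closed_Collect_eq continuous_on_sum coord continuous_on_const) auto
qed

text \<open>By Tychonoff the cube of sequences with values in [0, 1] is compact. The simplex is a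
  closed subset of it, since no coordinate exceeds the total mass 1.\<close>

lemma compact_coord_simplex: "compact (coord_simplex N)"
proof -
  have "compactin (product_topology (\<lambda>_ :: nat. euclidean) UNIV) (PiE UNIV (\<lambda>_. {0..1 :: real}))"
    by (subst compactin_PiE) auto
  then have "compact (PiE (UNIV :: nat set) (\<lambda>_. {0..1 :: real}))"
    by (simp add: euclidean_product_topology)
  moreover have "coord_simplex N \<subseteq> PiE UNIV (\<lambda>_. {0..1})"
  proof
    fix z assume z: "z \<in> coord_simplex N"
    have "z i \<le> 1" for i
    proof (cases "i < N")
      case True
      then have "z i \<le> (\<Sum>i<N. z i)"
        using z by (intro member_le_sum) (auto simp: coord_simplex_def)
      then show ?thesis using z by (simp add: coord_simplex_def)
    qed (use z in \<open>simp add: coord_simplex_def\<close>)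
    then show "z \<in> PiE UNIV (\<lambda>_. {0..1})" using z by (auto simp: coord_simplex_def PiE_def)
  qed
  ultimately show ?thesis
    using compact_Int_closed[OF _ closed_coord_simplex] by (metis Int_absorb1)
qed

lemma std_simplex_carrier: "std_simplex N \<subseteq> carrier_vec N"
  by (auto simp: std_simplex_def)

lemma closure_coords_simplex:
  assumes "S \<subseteq> std_simplex N"
  shows "closure (vec_coords ` S) \<subseteq> coord_simplex N"
proof (rule closure_minimal[OF _ closed_coord_simplex])
  have "vec_coords v \<in> coord_simplex N" if "v \<in> S" for v
  proof -
    have "v \<in> std_simplex N" using assms that by (rule subsetD)
    moreover from this have "v \<in> carrier_vec N" by (rule subsetD[OF std_simplex_carrier])
    ultimately show ?thesis by (simp only: vec_coords_simplex_iff)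
  qed
  then show "vec_coords ` S \<subseteq> coord_simplex N" by blast
qed

lemma vec_closure_simplex:
  assumes "S \<subseteq> std_simplex N"
  shows "vec_closure N S \<subseteq> std_simplex N"
proof
  fix v assume "v \<in> vec_closure N S"
  then have v: "v \<in> carrier_vec N" "vec_coords v \<in> closure (vec_coords ` S)"
    unfolding vec_closure_eq[OF order_trans[OF assms std_simplex_carrier]] by blast+
  have "vec_coords v \<in> coord_simplex N"
    using closure_coords_simplex[OF assms] v(2) by (rule subsetD)
  then show "v \<in> std_simplex N" by (simp only: vec_coords_simplex_iff[OF v(1)])
qed

lemma vec_closure_mono: "S \<subseteq> T \<Longrightarrow> vec_closure N S \<subseteq> vec_closure N T"
  unfolding vec_closure_def using closure_of_mono[OF image_mono] by fast

lemma vec_closure_superset: "S \<subseteq> carrier_vec N \<Longrightarrow> S \<subseteq> vec_closure N S"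
  unfolding vec_closure_eq using closure_subset by blast

text \<open>The matrix extends to a map \<open>L\<close> on sequences, continuous in the product
  topology because each output coordinate is a finite linear combination of input coordinates. A
  continuous map that sends a set into its closure also sends the closure into itself.\<close>

lemma vec_closure_invariant:
  assumes M: "M \<in> carrier_mat N N" and S: "S \<subseteq> carrier_vec N"
    and inv: "\<And>v. v \<in> S \<Longrightarrow> M *\<^sub>v v \<in> S" and v: "v \<in> vec_closure N S"
  shows "M *\<^sub>v v \<in> vec_closure N S"
proof -
  define L where "L z i = (if i < N then \<Sum>j<N. M $$ (i, j) * z j else 0)" for z :: "nat \<Rightarrow> real" and i
  have L: "L (vec_coords w) = vec_coords (M *\<^sub>v w)" if w: "w \<in> carrier_vec N" for w
  proof
    fix i
    show "L (vec_coords w) i = vec_coords (M *\<^sub>v w) i"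
    proof (cases "i < N")
      case True
      have "L (vec_coords w) i = (\<Sum>j<N. M $$ (i, j) * w $ j)"
        using True w by (simp add: L_def vec_coords_def)
      then show ?thesis
        using True M by (simp only: mult_mat_vec_nth[OF M w True, symmetric] vec_coords_def) auto
    qed (use M in \<open>auto simp: L_def vec_coords_def\<close>)
  qed
  have "continuous_on UNIV L"
  proof (rule continuous_on_coordinatewise_then_product)
    have "continuous_on UNIV (\<lambda>z. \<Sum>j<N. M $$ (i, j) * z j)" for i
      by (intro continuous_on_sum continuous_on_mult_left continuous_on_product_coordinates)
    then show "continuous_on UNIV (\<lambda>z. L z i)" for i
      by (cases "i < N") (simp_all add: L_def)
  qed
  then have cont: "continuous_on (closure (vec_coords ` S)) L"
    by (rule continuous_on_subset) simp
  have "L (vec_coords w) \<in> closure (vec_coords ` S)" if "w \<in> S" for w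
  proof -
    have "vec_coords (M *\<^sub>v w) \<in> closure (vec_coords ` S)"
      by (rule subsetD[OF closure_subset]) (rule imageI, rule inv[OF that])
    then show ?thesis by (simp only: L[OF subsetD[OF S that]])
  qed
  then have "L ` (vec_coords ` S) \<subseteq> closure (vec_coords ` S)"
    by blast
  then have "L ` closure (vec_coords ` S) \<subseteq> closure (vec_coords ` S)"
    by (rule image_closure_subset[OF cont closed_closure])
  moreover have v: "v \<in> carrier_vec N" "vec_coords v \<in> closure (vec_coords ` S)"
    using v unfolding vec_closure_eq[OF S] by blast+
  ultimately have "vec_coords (M *\<^sub>v v) \<in> closure (vec_coords ` S)"
    unfolding L[OF v(1), symmetric] by blast
  then show ?thesis
    using mult_mat_vec_carrier[OF M v(1)] by (simp add: vec_closure_eq[OF S])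
qed

text \<open>The closure is a closed subset of the compact simplex, so the squared distance attains
  its minimum on it. The minimiser is found among sequences and carried back to vectors.\<close>

lemma vec_closure_nearest_point:
  assumes S: "S \<subseteq> std_simplex N" and "S \<noteq> {}"
  obtains v where "v \<in> vec_closure N S"
    "\<And>w. w \<in> vec_closure N S \<Longrightarrow>
      (\<Sum>i<N. (v $ i - y $ i)\<^sup>2) \<le> (\<Sum>i<N. (w $ i - y $ i :: real)\<^sup>2)"
proof -
  have Sc: "S \<subseteq> carrier_vec N" using S std_simplex_carrier by blast
  let ?K = "closure (vec_coords ` S)"
  let ?d = "\<lambda>z :: nat \<Rightarrow> real. \<Sum>i<N. (z i - y $ i)\<^sup>2"
  have "compact ?K"
    using compact_Int_closed[OF compact_coord_simplex, of ?K N] closure_coords_simplex[OF S]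
    by (simp add: Int_absorb1)
  moreover have "continuous_on ?K ?d"
    by (intro continuous_intros continuous_on_subset[OF continuous_on_product_coordinates]) auto
  moreover have "?K \<noteq> {}" using \<open>S \<noteq> {}\<close> by simp
  ultimately obtain z where z: "z \<in> ?K" "\<And>z'. z' \<in> ?K \<Longrightarrow> ?d z \<le> ?d z'"
    using continuous_attains_inf[of ?K ?d] by blast
  have zv: "vec_coords (vec N z) = z"
    using z(1) closure_coords_simplex[OF S] by (intro vec_coords_vec) blast
  show thesis
  proof
    show "vec N z \<in> vec_closure N S"
      using z(1) zv by (simp add: vec_closure_eq[OF Sc])
    fix w assume "w \<in> vec_closure N S"
    then have "vec_coords w \<in> ?K" "w \<in> carrier_vec N" by (auto simp: vec_closure_eq[OF Sc])
    then show "(\<Sum>i<N. (vec N z $ i - y $ i)\<^sup>2) \<le> (\<Sum>i<N. (w $ i - y $ i)\<^sup>2)"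
      using z(2)[of "vec_coords w"] by (simp add: vec_coords_def)
  qed
qed

section \<open>States reached by finite control words\<close>

definition toy_step :: "real mat \<Rightarrow> real vec \<Rightarrow> real \<times> real mat \<Rightarrow> real vec" where
  "toy_step B v u = snd u *\<^sub>v (mat_exp ((- fst u) \<cdot>\<^sub>m B) *\<^sub>v v)"

text \<open>The initial state and all states just after a switch, described by finite lists of
  durations and permutations. Appending one letter gives invariance under every step, without gluing
  trajectories.\<close>

definition toy_orbit :: "nat \<Rightarrow> real mat \<Rightarrow> real vec \<Rightarrow> real vec set" where
  "toy_orbit N B x0 =
    {foldl (toy_step B) x0 us | us. \<forall>u \<in> set us. 0 \<le> fst u \<and> snd u \<in> perm_mats N}"

lemma toy_orbit_base: "x0 \<in> toy_orbit N B x0"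
  unfolding toy_orbit_def by (rule CollectI, rule exI[of _ "[]"]) simp

lemma toy_orbit_step:
  assumes "v \<in> toy_orbit N B x0" "0 \<le> t" "P \<in> perm_mats N"
  shows "P *\<^sub>v (mat_exp ((- t) \<cdot>\<^sub>m B) *\<^sub>v v) \<in> toy_orbit N B x0"
proof -
  obtain us where "v = foldl (toy_step B) x0 us" "\<forall>u \<in> set us. 0 \<le> fst u \<and> snd u \<in> perm_mats N"
    using assms(1) by (auto simp: toy_orbit_def)
  then show ?thesis
    unfolding toy_orbit_def using assms(2,3)
    by (intro CollectI exI[of _ "us @ [(t, P)]"]) (auto simp: toy_step_def)
qed

lemma perm_mat_id: "perm_mat N id = 1\<^sub>m N"
  by (auto simp: perm_mat_def)

lemma one_perm_mats: "1\<^sub>m N \<in> perm_mats N"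
  unfolding perm_mats_def using perm_mat_id permutes_id by (metis (mono_tags) CollectI)

text \<open>After a finite control word the switching times continue in steps of length one, so that
  they do not accumulate.\<close>

lemma toy_orbit_subset_reach:
  assumes B: "B \<in> carrier_mat N N" and x0: "x0 \<in> carrier_vec N"
  shows "toy_orbit N B x0 \<subseteq> toy_reach N B x0"
proof
  fix w assume "w \<in> toy_orbit N B x0"
  then obtain us where w: "w = foldl (toy_step B) x0 us"
    and us: "\<And>u. u \<in> set us \<Longrightarrow> 0 \<le> fst u \<and> snd u \<in> perm_mats N"
    by (auto simp: toy_orbit_def)
  define K where "K = length us"
  define dt where "dt k = (if k < K then fst (us ! k) else 1)" for k
  define P where "P k = (if k < K then snd (us ! k) else 1\<^sub>m N)" for k
  define \<tau> where "\<tau> k = (\<Sum>j<k. dt j)" for k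
  define \<xi> where "\<xi> = rec_nat x0 (\<lambda>k v. toy_step B v (dt k, P k))"
  \<comment> \<open>\<open>LEAST\<close> selects the interval that contains \<open>t\<close> and
    skips intervals of length zero.\<close>
  define x where "x t = (let k = LEAST k. t < \<tau> (Suc k) in
    mat_exp ((- (t - \<tau> k)) \<cdot>\<^sub>m B) *\<^sub>v \<xi> k)" for t
  have dt: "0 \<le> dt k" for k using us by (simp add: dt_def K_def)
  have P: "P k \<in> perm_mats N" for k using us one_perm_mats by (simp add: P_def K_def)
  have \<tau>0: "\<tau> 0 = 0" and \<tau>_Suc: "\<tau> (Suc k) = \<tau> k + dt k" for k by (simp_all add: \<tau>_def)
  have "mono \<tau>" by (rule incseq_SucI) (simp add: \<tau>_Suc dt)
  have \<xi>0: "\<xi> 0 = x0" and \<xi>_Suc: "\<xi> (Suc k) = toy_step B (\<xi> k) (dt k, P k)" for k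
    by (simp_all add: \<xi>_def)
  have exp_carrier: "mat_exp (t \<cdot>\<^sub>m B) \<in> carrier_mat N N" for t
    using B by (intro mat_exp_carrier) simp
  have \<xi>_carrier: "\<xi> k \<in> carrier_vec N" for k
  proof (induction k)
    case (Suc k)
    show ?case unfolding \<xi>_Suc toy_step_def snd_conv fst_conv
      by (rule mult_mat_vec_carrier[OF perm_mats_carrier[OF P]
          mult_mat_vec_carrier[OF exp_carrier Suc]])
  qed (simp add: \<xi>0 x0)
  have x_eq: "x t = mat_exp ((- (t - \<tau> k)) \<cdot>\<^sub>m B) *\<^sub>v \<xi> k" if "t \<in> {\<tau> k..<\<tau> (Suc k)}" for t k
  proof -
    have "(LEAST k. t < \<tau> (Suc k)) = k"
    proof (rule Least_equality)
      fix j assume "t < \<tau> (Suc j)"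
      show "k \<le> j"
      proof (rule ccontr)
        assume "\<not> k \<le> j"
        then have "\<tau> (Suc j) \<le> \<tau> k" using monoD[OF \<open>mono \<tau>\<close>, of "Suc j" k] by simp
        then show False using that \<open>t < \<tau> (Suc j)\<close> by simp
      qed
    qed (use that in simp)
    then show ?thesis by (simp add: x_def)
  qed
  have x_start: "x (\<tau> k) = \<xi> k" if "\<tau> k < \<tau> (Suc k)" for k
    using x_eq[of "\<tau> k" k] that mat_exp_zero[OF B] \<xi>_carrier[of k] by simp
  have \<xi>_take: "\<xi> k = foldl (toy_step B) x0 (take k us)" if "k \<le> K" for k
    using that
  proof (induction k)
    case (Suc k)
    then show ?case
      by (simp add: \<xi>_Suc take_Suc_conv_app_nth K_def[symmetric])
        (simp add: dt_def P_def)
  qed (simp add: \<xi>0)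
  have "toy_solution N B x0 \<tau> P x"
    unfolding toy_solution_def
  proof (intro conjI allI impI exI[of _ \<xi>] ballI)
    fix T :: real
    \<comment> \<open>Each step after the word adds one to \<tau>, so the switching times outgrow
      every bound.\<close>
    have far: "real k - real K \<le> \<tau> k" for k
    proof (induction k)
      case (Suc k)
      show ?case
      proof (cases "k < K")
        case True
        then have "real (Suc k) - real K \<le> 0" by simp
        also have "0 \<le> \<tau> (Suc k)" using \<open>mono \<tau>\<close> \<tau>0 monoD[of \<tau> 0 "Suc k"] by simp
        finally show ?thesis .
      qed (use Suc in \<open>simp add: \<tau>_Suc dt_def\<close>)
    qed (simp add: \<tau>0)
    have "{k. \<tau> k \<le> T} \<subseteq> {..nat \<lceil>T + real K\<rceil>}"
    proof clarify
      fix k assume "\<tau> k \<le> T"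
      then have "real k \<le> T + real K" using far[of k] by linarith
      then show "k \<le> nat \<lceil>T + real K\<rceil>" by linarith
    qed
    then show "finite {k. \<tau> k \<le> T}" using finite_subset by blast
  next
    fix t :: real
    show "x t \<in> carrier_vec N"
      unfolding x_def Let_def by (rule mult_mat_vec_carrier[OF exp_carrier \<xi>_carrier])
  next
    fix k
    show "\<xi> (Suc k) = P k *\<^sub>v (mat_exp ((- (\<tau> (Suc k) - \<tau> k)) \<cdot>\<^sub>m B) *\<^sub>v \<xi> k)"
      by (simp add: \<xi>_Suc toy_step_def \<tau>_Suc)
  next
    fix k t i assume t: "t \<in> {\<tau> k..<\<tau> (Suc k)}" and i: "i < N"
    show "((\<lambda>s. x s $ i) has_real_derivative (- (B *\<^sub>v x t)) $ i) (at t within {\<tau> k..<\<tau> (Suc k)})"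
    proof (rule has_field_derivative_transform_within[where d = 1])
      show "((\<lambda>u. (mat_exp ((- (u - \<tau> k)) \<cdot>\<^sub>m B) *\<^sub>v \<xi> k) $ i) has_real_derivative
          (- (B *\<^sub>v x t)) $ i) (at t within {\<tau> k..<\<tau> (Suc k)})"
        unfolding x_eq[OF t] by (rule mat_exp_flow[OF B \<xi>_carrier i])
    qed (use t in \<open>simp_all add: x_eq\<close>)
  qed (use \<tau>0 \<open>mono \<tau>\<close> P \<xi>0 x_start in auto)
  \<comment> \<open>Since \<open>dt K = 1\<close>, the interval right after the word is nonempty,
    and the trajectory really takes the value \<open>w\<close> at its start.\<close>
  moreover have "x (\<tau> K) = w"
    using x_start[of K] \<xi>_take[of K] w by (simp add: \<tau>_Suc dt_def K_def)
  moreover have "0 \<le> \<tau> K" using \<open>mono \<tau>\<close> \<tau>0 monoD[of \<tau> 0 K] by simp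
  ultimately show "w \<in> toy_reach N B x0" unfolding toy_reach_def by blast
qed

subsection \<open>Descent towards the target\<close>

lemma antimono_arrangement:
  fixes c :: "nat \<Rightarrow> real"
  obtains p where "p permutes {..<N}" "\<And>i j. i \<le> j \<Longrightarrow> j < N \<Longrightarrow> c (p j) \<le> c (p i)"
proof
  define xs where "xs = sort_key (\<lambda>i. - c i) [0..<N]"
  define p where "p k = (if k < N then xs ! k else k)" for k
  have len: "length xs = N" and set: "set xs = {..<N}" and "distinct xs"
    by (auto simp: xs_def)
  have "bij_betw (\<lambda>k. xs ! k) {..<N} {..<N}"
    by (rule bij_betw_nth[OF \<open>distinct xs\<close>]) (simp_all add: len set)
  then have "bij_betw p {..<N} {..<N}"
    by (rule bij_betw_cong[THEN iffD1, rotated]) (simp add: p_def)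
  then show "p permutes {..<N}"
    by (rule bij_imp_permutes) (simp add: p_def)
  fix i j assume ij: "i \<le> j" "j < N"
  have "sorted (map (\<lambda>i. - c i) xs)" by (simp add: xs_def)
  from sorted_nth_mono[OF this ij(1)] show "c (p j) \<le> c (p i)"
    using ij len by (simp add: p_def)
qed

text \<open>Every block is sorted, but unlike in a globally sorted arrangement the extreme values meet in
  the first block, so that block is not constant.\<close>

lemma ladder_arrangement:
  fixes c :: "nat \<Rightarrow> real"
  assumes n: "2 \<le> n" "n \<le> N"
  obtains q where "q permutes {..<N}"
    "\<And>k. Suc k < N \<Longrightarrow> Suc k mod n \<noteq> 0 \<Longrightarrow> c (q (Suc k)) \<le> c (q k)"
    "\<And>j. j < N \<Longrightarrow> c j \<le> c (q 0)"
    "\<And>j. j < N \<Longrightarrow> c (q (n - 1)) \<le> c j"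
proof -
  obtain p where p: "p permutes {..<N}"
    and anti: "\<And>i j. i \<le> j \<Longrightarrow> j < N \<Longrightarrow> c (p j) \<le> c (p i)"
    using antimono_arrangement[of N c] by blast
  \<comment> \<open>\<open>g\<close> assigns ranks to positions. The first block receives the
    largest value at its bottom, followed by the \<open>n - 1\<close> smallest; the ranks from
    \<open>1\<close> to \<open>N - n\<close> fill the other blocks in order.\<close>
  define g where "g k = (if k = 0 then 0 else if k < n then N - n + k
    else if k < N then k - n + 1 else k)" for k
  have "inj_on g {..<N}"
    using n by (auto simp: inj_on_def g_def split: if_splits)
  moreover have "g ` {..<N} \<subseteq> {..<N}"
    using n by (auto simp: g_def)
  ultimately have "bij_betw g {..<N} {..<N}"
    by (simp add: bij_betw_def endo_inj_surj)
  then have "g permutes {..<N}"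
    by (rule bij_imp_permutes) (use n in \<open>auto simp: g_def\<close>)
  then have perm: "(p \<circ> g) permutes {..<N}"
    using p by (rule permutes_compose)
  have onto: "\<exists>l<N. j = p l" if "j < N" for j
    using permutes_image[OF p] that by (metis imageE lessThan_iff)
  show thesis
  proof
    show "(p \<circ> g) permutes {..<N}" by (rule perm)
    show "c ((p \<circ> g) (Suc k)) \<le> c ((p \<circ> g) k)" if "Suc k < N" "Suc k mod n \<noteq> 0" for k
    proof -
      \<comment> \<open>Position \<open>n\<close> is the only one at which \<open>g\<close> can
        fall, and it starts a new block.\<close>
      have "Suc k \<noteq> n" using that(2) by auto
      then have "g k \<le> g (Suc k)" "g (Suc k) < N"
        using that(1) n by (auto simp: g_def)
      then show ?thesis using anti by simp
    qed
    fix j assume "j < N"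
    then obtain l where l: "l < N" "j = p l" using onto by blast
    show "c j \<le> c ((p \<circ> g) 0)" using anti[of 0 l] l by (simp add: g_def)
    have "g (n - 1) = N - 1" using n by (simp add: g_def)
    then show "c ((p \<circ> g) (n - 1)) \<le> c j" using anti[of l "N - 1"] l by simp
  qed
qed

text \<open>Both points have the same total mass: if \<open>v\<close> exceeded \<open>w\<close>
  nowhere, a coordinate where they differ would make the mass of \<open>v\<close> strictly
  smaller.\<close>

lemma std_simplex_excess:
  assumes v: "v \<in> std_simplex N" and w: "w \<in> std_simplex N" and "v \<noteq> w"
  obtains j where "j < N" "w $ j < v $ j"
proof -
  have "\<exists>j<N. w $ j < v $ j"
  proof (rule ccontr)
    assume "\<not> ?thesis"
    then have le: "v $ j \<le> w $ j" if "j < N" for j using that by force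
    have "dim_vec v = N" "dim_vec w = N" using v w by (auto simp: std_simplex_def)
    then obtain i where i: "i < N" "v $ i \<noteq> w $ i"
      using \<open>v \<noteq> w\<close> eq_vecI[of w v] by auto
    have "(\<Sum>j<N. v $ j) < (\<Sum>j<N. w $ j)"
      using le i by (intro sum_strict_mono_ex1) (auto intro!: bexI[of _ i] simp: order_less_le)
    then show False using v w by (simp add: std_simplex_def)
  qed
  then show thesis using that by blast
qed

text \<open>Abel summation. With \<open>f k\<close> the flow out of level \<open>k\<close>, the left
  side pairs \<open>a\<close> with the net gain of each level and the right side has one term per
  transition from \<open>Suc k\<close> to \<open>k\<close>. The boundary terms vanish by
  \<open>f 0 = 0\<close> below and by the guard above.\<close>

lemma sum_by_parts:
  fixes a f :: "nat \<Rightarrow> real"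
  assumes "f 0 = 0"
  shows "(\<Sum>k<Suc N. a k * ((if Suc k < Suc N then f (Suc k) else 0) - f k)) =
    (\<Sum>k<N. (a k - a (Suc k)) * f (Suc k))"
proof -
  have "(\<Sum>k<Suc N. a k * ((if Suc k < Suc N then f (Suc k) else 0) - f k)) =
      (\<Sum>k<Suc N. a k * (if Suc k < Suc N then f (Suc k) else 0)) - (\<Sum>k<Suc N. a k * f k)"
    by (simp only: right_diff_distrib sum_subtractf)
  also have "(\<Sum>k<Suc N. a k * (if Suc k < Suc N then f (Suc k) else 0)) =
      (\<Sum>k<N. a k * f (Suc k))"
    by simp
  also have "(\<Sum>k<Suc N. a k * f k) = (\<Sum>k<N. a (Suc k) * f (Suc k))"
    unfolding sum.lessThan_Suc_shift by (simp add: assms)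
  finally show ?thesis by (simp only: left_diff_distrib sum_subtractf)
qed

text \<open>The sum is half the derivative at time 0 of the squared distance between the relaxing
  rearrangement of \<open>v\<close> and the same rearrangement of \<open>y\<close>. By parts, its
  negative is a sum over transitions of the drop in y - v times the flow: nonnegative inside chains,
  zero between chains, positive at one place in the first chain.\<close>

lemma ladder_descent_direction:
  assumes n: "2 \<le> n" "n \<le> N"
    and v: "v \<in> std_simplex N" and y: "y \<in> std_simplex N" and "v \<noteq> y"
  obtains q where "q permutes {..<N}"
    "(\<Sum>k<N. (v $ q k - y $ q k) * ((if Suc k < N then ladder_rate n (Suc k) * v $ q (Suc k) else 0) -
      ladder_rate n k * v $ q k)) < 0"
proof -
  let ?c = "\<lambda>i. y $ i - v $ i" and ?s = "ladder_rate n"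
  obtain q where q: "q permutes {..<N}"
    and anti: "\<And>k. Suc k < N \<Longrightarrow> Suc k mod n \<noteq> 0 \<Longrightarrow> ?c (q (Suc k)) \<le> ?c (q k)"
    and top: "\<And>j. j < N \<Longrightarrow> ?c j \<le> ?c (q 0)"
    and bot: "\<And>j. j < N \<Longrightarrow> ?c (q (n - 1)) \<le> ?c j"
    using ladder_arrangement[OF n, of ?c] by blast
  have q_less: "q k < N" if "k < N" for k using permutes_in_image[OF q] that by auto
  obtain i where i: "i < N" "v $ i < y $ i"
    using std_simplex_excess[OF y v] \<open>v \<noteq> y\<close> by blast
  obtain j where j: "j < N" "y $ j < v $ j"
    using std_simplex_excess[OF v y \<open>v \<noteq> y\<close>] by blast
  have neg: "?c (q (n - 1)) < 0" using bot[OF j(1)] j(2) by simp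
  have pos: "0 < ?c (q 0)" using top[OF i(1)] i(2) by simp
  \<comment> \<open>The first position with the minimal value of y - v lies in the first chain,
    because \<open>n - 1\<close> has that value, and not at the bottom, where the value is positive.
    The value therefore drops strictly on the transition into it.\<close>
  define l where "l = (LEAST l. ?c (q l) = ?c (q (n - 1)))"
  have l: "?c (q l) = ?c (q (n - 1))" unfolding l_def by (rule LeastI) (rule refl)
  have "l \<le> n - 1" unfolding l_def by (rule Least_le) (rule refl)
  have "l \<noteq> 0"
  proof
    assume "l = 0"
    then show False using l neg pos by simp
  qed
  then obtain k where k: "l = Suc k" using not0_implies_Suc by blast
  then have kn: "Suc k < n" using \<open>l \<le> n - 1\<close> n by simp
  then have kN: "Suc k < N" using n by simp
  have "?c (q k) \<noteq> ?c (q (n - 1))"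
    using not_less_Least[of k "\<lambda>l. ?c (q l) = ?c (q (n - 1))"] k unfolding l_def by simp
  then have drop: "?c (q (Suc k)) < ?c (q k)"
    using anti[OF kN] kn l k by force
  have "0 \<le> y $ q (Suc k)" using y q_less[OF kN] by (simp add: std_simplex_def)
  then have vpos: "0 < v $ q (Suc k)" using l neg k by simp
  have spos: "0 < ?s (Suc k)" using kn by (simp add: ladder_rate_def)
  obtain N' where N': "N = Suc N'" using kN by (cases N) auto
  let ?t = "\<lambda>k. (?c (q k) - ?c (q (Suc k))) * (?s (Suc k) * v $ q (Suc k))"
  have "0 < ?t k" using drop vpos spos by simp
  moreover have "0 \<le> ?t k'" if "k' < N'" for k'
  \<comment> \<open>Across a chain boundary the order of the values is uncontrolled, but the rate is
    zero.\<close>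
  proof (cases "Suc k' mod n = 0")
    case False
    have "Suc k' < N" using that N' by simp
    then have "?c (q (Suc k')) \<le> ?c (q k')" "0 \<le> v $ q (Suc k')"
      using anti False v q_less by (auto simp: std_simplex_def)
    then show ?thesis using ladder_rate_nonneg[of n "Suc k'"] by (intro mult_nonneg_nonneg) auto
  qed (simp add: ladder_rate_def)
  ultimately have "0 < (\<Sum>k<N'. ?t k)"
    using kN N' by (intro sum_pos2[where i = k]) auto
  also have "\<dots> = (\<Sum>k<N. ?c (q k) * ((if Suc k < N then ?s (Suc k) * v $ q (Suc k) else 0) -
      ?s k * v $ q k))"
    unfolding N' using sum_by_parts[of "\<lambda>k. ?s k * v $ q k" "\<lambda>k. ?c (q k)" N']
    by (simp only: ladder_rate_def mod_0 of_nat_0 mult_zero_left)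
  also have "\<dots> = - (\<Sum>k<N. (v $ q k - y $ q k) *
      ((if Suc k < N then ?s (Suc k) * v $ q (Suc k) else 0) - ?s k * v $ q k))"
    unfolding sum_negf[symmetric] by (intro sum.cong refl) (simp only: minus_mult_left minus_diff_eq)
  finally show thesis using that[OF q] by simp
qed

lemma vec_closure_toy_orbit:
  assumes n: "2 \<le> n" "n \<le> N" and x0: "x0 \<in> std_simplex N"
    and orbit: "toy_orbit N (decay_mat N (ladder_rate n)) x0 \<subseteq> std_simplex N"
  shows "std_simplex N \<subseteq> vec_closure N (toy_orbit N (decay_mat N (ladder_rate n)) x0)"
proof
  fix y assume y: "y \<in> std_simplex N"
  let ?B = "decay_mat N (ladder_rate n)"
  let ?O = "toy_orbit N ?B x0"
  note B = decay_mat_carrier[of N "ladder_rate n"]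
  have O: "?O \<subseteq> carrier_vec N" using orbit std_simplex_carrier by (rule order_trans)
  have E: "mat_exp ((- t) \<cdot>\<^sub>m ?B) \<in> carrier_mat N N" for t
    by (rule mat_exp_carrier) (simp add: decay_mat_def)
  have step: "P *\<^sub>v (mat_exp ((- t) \<cdot>\<^sub>m ?B) *\<^sub>v u) \<in> vec_closure N ?O"
    if u: "u \<in> vec_closure N ?O" and "0 \<le> t" "P \<in> perm_mats N" for u t P
  proof -
    \<comment> \<open>Relaxation followed by permutation is a single matrix, to which
      \<open>vec_closure_invariant\<close> applies.\<close>
    let ?M = "P * mat_exp ((- t) \<cdot>\<^sub>m ?B)"
    note P = perm_mats_carrier[OF \<open>P \<in> perm_mats N\<close>]
    have uc: "u \<in> carrier_vec N" using u by (simp add: vec_closure_def)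
    have assoc: "?M *\<^sub>v u' = P *\<^sub>v (mat_exp ((- t) \<cdot>\<^sub>m ?B) *\<^sub>v u')" if "u' \<in> carrier_vec N" for u'
      using P E that by (rule assoc_mult_mat_vec)
    have "?M *\<^sub>v u \<in> vec_closure N ?O"
    proof (rule vec_closure_invariant[OF mult_carrier_mat[OF P E] O _ u])
      fix u' assume u': "u' \<in> ?O"
      show "?M *\<^sub>v u' \<in> ?O"
        unfolding assoc[OF subsetD[OF O u']] using u' that(2,3) by (rule toy_orbit_step)
    qed
    then show ?thesis unfolding assoc[OF uc] .
  qed
  have E0: "mat_exp ((- 0) \<cdot>\<^sub>m ?B) *\<^sub>v u = u" if "u \<in> carrier_vec N" for u
    using that mat_exp_zero[OF B] by simp
  have "?O \<noteq> {}" using toy_orbit_base by blast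
  then obtain v where v: "v \<in> vec_closure N ?O"
    and nearest: "\<And>w. w \<in> vec_closure N ?O \<Longrightarrow>
      (\<Sum>i<N. (v $ i - y $ i)\<^sup>2) \<le> (\<Sum>i<N. (w $ i - y $ i)\<^sup>2)"
    using vec_closure_nearest_point[OF orbit, of y] by blast
  have vs: "v \<in> std_simplex N" using vec_closure_simplex[OF orbit] v by (rule subsetD)
  have vc: "v \<in> carrier_vec N" using vs by (rule subsetD[OF std_simplex_carrier])
  have "v = y"
  proof (rule ccontr)
    assume "v \<noteq> y"
    from ladder_descent_direction[OF n vs y this] obtain q where q: "q permutes {..<N}"
      and descent: "(\<Sum>k<N. (v $ q k - y $ q k) *
        ((if Suc k < N then ladder_rate n (Suc k) * v $ q (Suc k) else 0) - ladder_rate n k * v $ q k)) < 0" .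
    have q_less: "q k < N" if "k < N" for k using permutes_in_image[OF q] that by auto
    \<comment> \<open>\<open>?R\<close> brings entry \<open>q k\<close> to position
      \<open>k\<close>, the arrangement in which relaxation approaches the target. \<open>?Q\<close>
      undoes it, so that distances are measured to \<open>y\<close> itself.\<close>
    let ?Q = "perm_mat N q" and ?R = "perm_mat N (inv_into UNIV q)"
    have Q: "?Q \<in> perm_mats N" and R: "?R \<in> perm_mats N"
      using q permutes_inv[OF q] by (auto simp: perm_mats_def)
    define w where "w = ?R *\<^sub>v v"
    have wc: "w \<in> carrier_vec N"
      unfolding w_def by (rule mult_mat_vec_carrier[OF perm_mats_carrier[OF R] vc])
    have w_nth: "w $ k = v $ q k" if "k < N" for k
      using perm_mat_mult_vec[OF permutes_inv[OF q] vc q_less[OF that]]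
      unfolding w_def permutes_inverses(2)[OF q] .
    \<comment> \<open>A step of duration zero is a pure permutation.\<close>
    have w_closure: "w \<in> vec_closure N ?O"
      using step[OF v order_refl R] unfolding E0[OF vc] w_def .
    define x where "x t = mat_exp ((- (t - 0)) \<cdot>\<^sub>m ?B) *\<^sub>v w" for t
    have x0: "x 0 = w" using E0[OF wc] by (simp add: x_def)
    \<comment> \<open>Permutations preserve distances, so \<open>f t\<close> is also the squared
      distance from \<open>?Q *\<^sub>v x t\<close> to \<open>y\<close>, which cannot fall below the
      minimum.\<close>
    define f where "f t = (\<Sum>k<N. (x t $ k - y $ q k)\<^sup>2)" for t
    have f_le: "f 0 \<le> f t" if "0 \<le> t" for t
    proof -
      have "f 0 = (\<Sum>k<N. (v $ q k - y $ q k)\<^sup>2)"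
        unfolding f_def x0 by (intro sum.cong refl) (simp add: w_nth)
      also have "\<dots> = (\<Sum>i<N. (v $ i - y $ i)\<^sup>2)"
        using sum.permute[OF q, of "\<lambda>i. (v $ i - y $ i)\<^sup>2"] by (simp add: comp_def)
      also have "\<dots> \<le> (\<Sum>i<N. ((?Q *\<^sub>v x t) $ i - y $ i)\<^sup>2)"
        using step[OF w_closure that Q] unfolding x_def by (intro nearest) simp
      also have "\<dots> = (\<Sum>k<N. ((?Q *\<^sub>v x t) $ q k - y $ q k)\<^sup>2)"
        using sum.permute[OF q, of "\<lambda>i. ((?Q *\<^sub>v x t) $ i - y $ i)\<^sup>2"] by (simp add: comp_def)
      also have "\<dots> = f t"
      proof -
        have "x t \<in> carrier_vec N" unfolding x_def by (rule mult_mat_vec_carrier[OF E wc])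
        then show ?thesis
          unfolding f_def by (intro sum.cong refl) (simp only: perm_mat_mult_vec[OF q] lessThan_iff)
      qed
      finally show ?thesis .
    qed
    let ?D = "\<Sum>k<N. 2 * (x 0 $ k - y $ q k) * (- (?B *\<^sub>v x 0)) $ k"
    have "(f has_real_derivative ?D) (at 0)"
    proof -
      have "((\<lambda>t. (x t $ k - y $ q k)\<^sup>2) has_real_derivative
          2 * (x 0 $ k - y $ q k) * (- (?B *\<^sub>v x 0)) $ k) (at 0)" if "k < N" for k
      proof -
        have "((\<lambda>t. x t $ k) has_real_derivative (- (?B *\<^sub>v x 0)) $ k) (at 0)"
          unfolding x_def by (rule mat_exp_flow[OF B wc that])
        from DERIV_power[OF DERIV_diff[OF this DERIV_const[of "y $ q k"]], of 2] show ?thesis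
          by (simp add: algebra_simps)
      qed
      then show ?thesis unfolding f_def[abs_def] by (intro DERIV_sum) simp
    qed
    moreover have "?D < 0"
    proof -
      have "?D = 2 * (\<Sum>k<N. (v $ q k - y $ q k) *
        ((if Suc k < N then ladder_rate n (Suc k) * v $ q (Suc k) else 0) - ladder_rate n k * v $ q k))"
        unfolding sum_distrib_left x0
      proof (intro sum.cong refl)
        fix k assume "k \<in> {..<N}"
        then have k: "k < N" by simp
        have "(- (?B *\<^sub>v w)) $ k = - ((?B *\<^sub>v w) $ k)"
          using k B by simp
        then show "2 * (w $ k - y $ q k) * (- (?B *\<^sub>v w)) $ k = 2 * ((v $ q k - y $ q k) *
          ((if Suc k < N then ladder_rate n (Suc k) * v $ q (Suc k) else 0) - ladder_rate n k * v $ q k))"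
          unfolding decay_mat_mult_vec[OF wc k] using k by (simp add: w_nth)
      qed
      then show ?thesis using descent by simp
    qed
    \<comment> \<open>A negative derivative yields strictly closer points at small positive times,
      which \<open>f_le\<close> excludes.\<close>
    ultimately obtain d where "0 < d" "\<And>h. 0 < h \<Longrightarrow> h < d \<Longrightarrow> f (0 + h) < f 0"
      using DERIV_neg_dec_right by blast
    from this(2)[of "d / 2"] \<open>0 < d\<close> f_le[of "d / 2"] show False by simp
  qed
  then show "y \<in> vec_closure N ?O" using v by simp
qed

section \<open>Density of the reachable set in the simplex\<close>

theorem theorem2:
  fixes m n :: nat and V :: "complex mat" and \<Gamma> :: "complex mat \<Rightarrow> complex mat"
    and B0 :: "real mat" and x0 :: "real vec"
  assumes "m \<ge> 1" and "n \<ge> 1"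
    and "V = kron (1\<^sub>m (n ^ (m - 1))) (sigma_plus n)"
    and "\<Gamma> = gksl (n ^ m) [V]"
    and "B0 = diag_rep (n ^ m) \<Gamma>"
    and "x0 \<in> std_simplex (n ^ m)"
  shows "vec_closure (n ^ m) (toy_reach (n ^ m) B0 x0) = std_simplex (n ^ m)"
proof -
  let ?N = "n ^ m"
  have "n ^ (m - 1) * n = ?N" using \<open>m \<ge> 1\<close> by (intro power_minus_mult) simp
  then have B0: "B0 = decay_mat ?N (ladder_rate n)"
    using diag_rep_gksl_ladder[OF \<open>n \<ge> 1\<close>, of "n ^ (m - 1)"] assms(3-5) by simp
  \<comment> \<open>The reachable set is caught between the orbit and the simplex, so density of the
    orbit decides the claim.\<close>
  have reach: "toy_reach ?N B0 x0 \<subseteq> std_simplex ?N"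
    unfolding B0 using ladder_rate_nonneg assms(6)
    by (intro toy_reach_simplex) (simp_all add: ladder_rate_def)
  have sub: "toy_orbit ?N B0 x0 \<subseteq> toy_reach ?N B0 x0"
    unfolding B0 using assms(6) std_simplex_carrier
    by (intro toy_orbit_subset_reach decay_mat_carrier) blast
  have "std_simplex ?N \<subseteq> vec_closure ?N (toy_orbit ?N B0 x0)"
  proof (cases "n = 1")
    \<comment> \<open>The descent argument needs chains with at least two levels. For
      \<open>n = 1\<close> the dimension is \<open>1\<close> and the simplex is a single
      point.\<close>
    case True
    have "y = x0" if "y \<in> std_simplex ?N" for y
      using that assms(6) True by (auto simp: std_simplex_def intro!: eq_vecI)
    moreover have "toy_orbit ?N B0 x0 \<subseteq> carrier_vec ?N"
      using sub reach std_simplex_carrier by (metis order_trans)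
    ultimately show ?thesis
      using toy_orbit_base[of x0 ?N B0] vec_closure_superset by blast
  next
    case False
    then have "2 \<le> n" using \<open>n \<ge> 1\<close> by simp
    moreover have "n \<le> ?N" using \<open>m \<ge> 1\<close> \<open>n \<ge> 1\<close> by (simp add: self_le_power)
    ultimately show ?thesis
      using vec_closure_toy_orbit[OF _ _ assms(6)] sub reach unfolding B0 by (meson order_trans)
  qed
  then show ?thesis
    using vec_closure_mono[OF sub] vec_closure_simplex[OF reach] by blast
qed

end
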